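(* Let $V$ be a (complex) Banach space having the Bohl-Bohr property. Let $A$ be a constant $p\times p$ matrix whose eigenvalues $\{\mu_i\}_{i=1}^p$ satisfy $|\mu_i|=1$, and let $f\in AA(\mathbb{R},V^p)$. Then any bounded solution $y$ of $y'=Ay+f(t)$ belongs to $AA(\mathbb{R},V^p)$. When all the eigenvalues $\mu_i$ are distinct, these solutions have the form $$y(t)=\exp(At)\left[v+\int_0^t\exp(-As)f(s)\,ds\right],\qquad v\in V^p.$$
   Context: For a Banach space $W$, $AA(\mathbb{R},W)$ is the set of almost automorphic functions: continuous $\psi:\mathbb{R}\to W$ such that every real sequence has a subsequence $\{\tau_n\}$ for which $\tilde\psi(t)=\lim_n\psi(t+\tau_n)$ and $\psi(t)=\lim_n\tilde\psi(t-\tau_n)$ (pointwise) for all $t\in\mathbb{R}$. A Banach space $V$ has the Bohl-Bohr property if for every $f\in AA(\mathbb{R},V)$ the function $F(t)=\int_0^tf(s)\,ds$ is in $AA(\mathbb{R},V)$ if and only if it is bounded. *)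

theory Defs
  imports "HOL-Analysis.Analysis"
begin

text \<open>Complex Banach spaces. The law \<open>1 *\<^sub>C x = x\<close> is the case \<open>r = 1\<close> of \<open>scaleC_of_real\<close>.\<close>

class complex_banach = banach +
  fixes scaleC :: "complex \<Rightarrow> 'a \<Rightarrow> 'a"  (infixr "*\<^sub>C" 75)
  assumes scaleC_add_right: "c *\<^sub>C (x + y) = c *\<^sub>C x + c *\<^sub>C y"
    and scaleC_add_left: "(c + d) *\<^sub>C x = c *\<^sub>C x + d *\<^sub>C x"
    and scaleC_scaleC: "c *\<^sub>C (d *\<^sub>C x) = (c * d) *\<^sub>C x"
    and scaleC_of_real: "complex_of_real r *\<^sub>C x = r *\<^sub>R x"
    and norm_scaleC: "norm (c *\<^sub>C x) = cmod c * norm x"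

instantiation complex :: complex_banach
begin

definition scaleC_complex :: "complex \<Rightarrow> complex \<Rightarrow> complex"
  where "scaleC_complex = (*)"

instance
  by standard
    (simp_all add: scaleC_complex_def algebra_simps norm_mult scaleR_conv_of_real)

end

definition almost_automorphic :: "(real \<Rightarrow> 'w::banach) \<Rightarrow> bool"
  where "almost_automorphic \<psi> \<longleftrightarrow>
    continuous_on UNIV \<psi> \<and>
    (\<forall>\<sigma> :: nat \<Rightarrow> real. \<exists>r :: nat \<Rightarrow> nat. strict_mono r \<and>
      (\<exists>\<psi>'. \<forall>t. (\<lambda>n. \<psi> (t + \<sigma> (r n))) \<longlonglongrightarrow> \<psi>' t \<and>
                 (\<lambda>n. \<psi>' (t - \<sigma> (r n))) \<longlonglongrightarrow> \<psi> t))"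

text \<open>The oriented integral \<open>\<integral>\<^sub>a\<^sup>b f(s) ds\<close>. The Henstock-Kurzweil integral is used because
  \<open>interval_lebesgue_integral\<close> requires a second countable codomain.\<close>

definition oriented_integral :: "real \<Rightarrow> real \<Rightarrow> (real \<Rightarrow> 'w::banach) \<Rightarrow> 'w"
  where "oriented_integral a b f =
    (if a \<le> b then integral {a..b} f else - integral {b..a} f)"

definition bohl_bohr :: "'v::banach itself \<Rightarrow> bool"
  where "bohl_bohr _ \<longleftrightarrow>
    (\<forall>f :: real \<Rightarrow> 'v. almost_automorphic f \<longrightarrow>
      (almost_automorphic (\<lambda>t. oriented_integral 0 t f) \<longleftrightarrow>
       bounded (range (\<lambda>t. oriented_integral 0 t f))))"

text \<open>The action of a complex \<open>p \<times> p\<close> matrix on \<open>V\<^sup>p\<close>.\<close>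

definition mat_act :: "complex^'p^'p \<Rightarrow> 'v::complex_banach^'p \<Rightarrow> 'v^'p"  (infixr "*\<^sub>V" 75)
  where "A *\<^sub>V y = (\<chi> i. \<Sum>j\<in>UNIV. A $ i $ j *\<^sub>C y $ j)"

text \<open>The power series is written out with the matrix product \<open>**\<close>, since \<open>*\<close> on type \<open>vec\<close>
  is componentwise.\<close>

definition mat_exp :: "complex^'p^'p \<Rightarrow> complex^'p^'p"
  where "mat_exp A = (\<Sum>k. (((**) A) ^^ k) (mat 1) /\<^sub>R fact k)"

text \<open>The family \<open>\<mu>\<close> lists the eigenvalues of \<open>A\<close>, i.e. the roots of its characteristic
  polynomial, repeated according to algebraic multiplicity.\<close>

definition eigenvalue_family :: "complex^'p^'p \<Rightarrow> ('p \<Rightarrow> complex) \<Rightarrow> bool"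
  where "eigenvalue_family A \<mu> \<longleftrightarrow>
    (\<forall>x. det (mat x - A) = (\<Prod>i\<in>UNIV. x - \<mu> i))"

end

theory Submission
  imports Defs "HOL-Computational_Algebra.Fundamental_Theorem_Algebra"
begin

text \<open>Some nonzero polynomial annihilates \<open>A\<close>. Splitting off one linear factor \<open>x - a\<close> at a time,
  \<open>z = (A - a) y\<close> is a bounded solution of \<open>z' = A z + (A - a) f\<close> annihilated by a polynomial of
  smaller degree, hence almost automorphic by induction, and \<open>y' = a y + (z + f)\<close> splits into
  scalar equations. A bounded solution of \<open>u' = a u + g\<close> is almost automorphic: for \<open>Re a = 0\<close>
  the Bohl-Bohr property applies to the derivative \<open>exp (- a t) g\<close> of \<open>exp (- a t) u\<close>; for \<open>Re a > 0\<close>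
  one has \<open>\<parallel>u t\<parallel> \<le> \<integral>\<^sub>0\<^sup>\<infinity> exp (- Re a s) \<parallel>g (t + s)\<parallel> ds\<close>, and the same estimate for differences of
  translates carries the convergence from \<open>g\<close> over to \<open>u\<close>; for \<open>Re a < 0\<close> time is reversed.\<close>

section \<open>Complex scalar multiplication as a bounded bilinear map\<close>

lemma bounded_bilinear_scaleC:
  "bounded_bilinear ((*\<^sub>C) :: complex \<Rightarrow> 'a \<Rightarrow> 'a::complex_banach)"
proof
  fix c d :: complex and x y :: 'a and r :: real
  show "(c + d) *\<^sub>C x = c *\<^sub>C x + d *\<^sub>C x"
    by (rule scaleC_add_left)
  show "c *\<^sub>C (x + y) = c *\<^sub>C x + c *\<^sub>C y"
    by (rule scaleC_add_right)
  show "(r *\<^sub>R c) *\<^sub>C x = r *\<^sub>R (c *\<^sub>C x)"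
    by (metis scaleC_of_real scaleC_scaleC scaleR_conv_of_real)
  show "c *\<^sub>C (r *\<^sub>R x) = r *\<^sub>R (c *\<^sub>C x)"
    by (metis mult.commute scaleC_of_real scaleC_scaleC)
  show "\<exists>K. \<forall>(c::complex) (x::'a). norm (c *\<^sub>C x) \<le> norm c * norm x * K"
    by (rule exI [of _ 1]) (simp add: norm_scaleC)
qed

interpretation scaleC: bounded_bilinear "(*\<^sub>C) :: complex \<Rightarrow> 'a \<Rightarrow> 'a::complex_banach"
  by (rule bounded_bilinear_scaleC)

lemma scaleC_one: "1 *\<^sub>C x = x"
  using scaleC_of_real [of 1 x] by simp

section \<open>Almost automorphic functions and their closure properties\<close>

lemma almost_automorphicE:
  assumes "almost_automorphic \<psi>"
  obtains r :: "nat \<Rightarrow> nat" and \<psi>' where "strict_mono r"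
    "\<And>t. (\<lambda>n. \<psi> (t + \<sigma> (r n))) \<longlonglongrightarrow> \<psi>' t"
    "\<And>t. (\<lambda>n. \<psi>' (t - \<sigma> (r n))) \<longlonglongrightarrow> \<psi> t"
  using assms unfolding almost_automorphic_def by metis

lemma almost_automorphicI:
  assumes "continuous_on UNIV \<psi>"
    and "\<And>\<sigma> :: nat \<Rightarrow> real. \<exists>r \<psi>'. strict_mono (r :: nat \<Rightarrow> nat) \<and>
      (\<forall>t. (\<lambda>n. \<psi> (t + \<sigma> (r n))) \<longlonglongrightarrow> \<psi>' t) \<and>
      (\<forall>t. (\<lambda>n. \<psi>' (t - \<sigma> (r n))) \<longlonglongrightarrow> \<psi> t)"
  shows "almost_automorphic \<psi>"
  using assms unfolding almost_automorphic_def by metis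

lemma almost_automorphic_continuous:
  "almost_automorphic \<psi> \<Longrightarrow> continuous_on UNIV \<psi>"
  by (simp add: almost_automorphic_def)

text \<open>If the norm of \<psi> exceeded n at some \<sigma> n for every n, then no subsequence of
  \<open>\<psi> (\<sigma> n)\<close> could converge, while the definition at t = 0 supplies one that
  does.\<close>

lemma almost_automorphic_bounded:
  assumes "almost_automorphic \<psi>"
  shows "bounded (range \<psi>)"
proof (rule ccontr)
  assume "\<not> bounded (range \<psi>)"
  then have "\<exists>t. norm (\<psi> t) > real n" for n
    by (auto simp: bounded_iff not_le)
  then obtain \<sigma> where \<sigma>: "\<And>n. norm (\<psi> (\<sigma> n)) > real n"
    by metis
  obtain r \<psi>' where r: "strict_mono (r :: nat \<Rightarrow> nat)"
    and lim: "\<And>t. (\<lambda>n. \<psi> (t + \<sigma> (r n))) \<longlonglongrightarrow> \<psi>' t"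
    using almost_automorphicE [OF assms, of \<sigma>] by metis
  have "Bseq (\<lambda>n. \<psi> (\<sigma> (r n)))"
    using lim [of 0] by (simp add: convergent_imp_Bseq convergentI)
  then obtain K where K: "\<And>n. norm (\<psi> (\<sigma> (r n))) \<le> K"
    by (auto simp: Bseq_def)
  obtain n where "real n > K"
    using reals_Archimedean2 by blast
  moreover have "real n \<le> real (r n)"
    using r by (simp add: seq_suble)
  ultimately show False
    using K [of n] \<sigma> [of "r n"] by linarith
qed

lemma almost_automorphic_const: "almost_automorphic (\<lambda>t. c)"
  by (rule almost_automorphicI)
    (auto intro!: exI [of _ id] exI [of _ "\<lambda>t. c"] strict_mono_id)

text \<open>Both limits in the definition are pointwise, so plain continuity of \<phi> carries them
  over with the same subsequence.\<close>

lemma almost_automorphic_compose: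
  assumes "almost_automorphic \<psi>" and "continuous_on UNIV \<phi>"
  shows "almost_automorphic (\<lambda>t. \<phi> (\<psi> t))"
proof (rule almost_automorphicI)
  show "continuous_on UNIV (\<lambda>t. \<phi> (\<psi> t))"
    using assms almost_automorphic_continuous continuous_on_compose2 by blast
  have lim: "(\<lambda>n. \<phi> (X n)) \<longlonglongrightarrow> \<phi> l" if "X \<longlonglongrightarrow> l" for X l
    using continuous_on_tendsto_compose [OF assms(2) that] by simp
  fix \<sigma> :: "nat \<Rightarrow> real"
  show "\<exists>r \<psi>'. strict_mono (r :: nat \<Rightarrow> nat) \<and>
      (\<forall>t. (\<lambda>n. \<phi> (\<psi> (t + \<sigma> (r n)))) \<longlonglongrightarrow> \<psi>' t) \<and>
      (\<forall>t. (\<lambda>n. \<psi>' (t - \<sigma> (r n))) \<longlonglongrightarrow> \<phi> (\<psi> t))"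
  proof -
    obtain r \<psi>' where "strict_mono (r :: nat \<Rightarrow> nat)"
      "\<And>t. (\<lambda>n. \<psi> (t + \<sigma> (r n))) \<longlonglongrightarrow> \<psi>' t"
      "\<And>t. (\<lambda>n. \<psi>' (t - \<sigma> (r n))) \<longlonglongrightarrow> \<psi> t"
      using almost_automorphicE [OF assms(1), of \<sigma>] by metis
    then show ?thesis
      by (intro exI [of _ r] exI [of _ "\<lambda>t. \<phi> (\<psi>' t)"]) (auto intro: lim)
  qed
qed

text \<open>The subsequence r obtained for \<psi> is refined by q to serve \<phi> as well; the
  limits for \<psi> survive the refinement. Together with composition this yields closure under
  every continuous binary operation.\<close>

lemma almost_automorphic_Pair:
  assumes "almost_automorphic \<psi>" and "almost_automorphic \<phi>"
  shows "almost_automorphic (\<lambda>t. (\<psi> t, \<phi> t))"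
proof (rule almost_automorphicI)
  show "continuous_on UNIV (\<lambda>t. (\<psi> t, \<phi> t))"
    using assms by (intro continuous_intros almost_automorphic_continuous)
  fix \<sigma> :: "nat \<Rightarrow> real"
  obtain r \<psi>' where r: "strict_mono (r :: nat \<Rightarrow> nat)"
    and \<psi>': "\<And>t. (\<lambda>n. \<psi> (t + \<sigma> (r n))) \<longlonglongrightarrow> \<psi>' t"
      "\<And>t. (\<lambda>n. \<psi>' (t - \<sigma> (r n))) \<longlonglongrightarrow> \<psi> t"
    using almost_automorphicE [OF assms(1), of \<sigma>] by metis
  obtain q \<phi>' where q: "strict_mono (q :: nat \<Rightarrow> nat)"
    and \<phi>': "\<And>t. (\<lambda>n. \<phi> (t + \<sigma> (r (q n)))) \<longlonglongrightarrow> \<phi>' t"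
      "\<And>t. (\<lambda>n. \<phi>' (t - \<sigma> (r (q n)))) \<longlonglongrightarrow> \<phi> t"
    using almost_automorphicE [OF assms(2), of "\<sigma> \<circ> r"] by auto
  have "(\<lambda>n. \<psi> (t + \<sigma> (r (q n)))) \<longlonglongrightarrow> \<psi>' t" "(\<lambda>n. \<psi>' (t - \<sigma> (r (q n)))) \<longlonglongrightarrow> \<psi> t" for t
    using LIMSEQ_subseq_LIMSEQ [OF \<psi>'(1) q, of t] LIMSEQ_subseq_LIMSEQ [OF \<psi>'(2) q, of t]
    by (simp_all add: o_def)
  then show "\<exists>r \<omega>. strict_mono (r :: nat \<Rightarrow> nat) \<and>
      (\<forall>t. (\<lambda>n. (\<psi> (t + \<sigma> (r n)), \<phi> (t + \<sigma> (r n)))) \<longlonglongrightarrow> \<omega> t) \<and>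
      (\<forall>t. (\<lambda>n. \<omega> (t - \<sigma> (r n))) \<longlonglongrightarrow> (\<psi> t, \<phi> t))"
    using strict_mono_compose [OF r q] \<phi>'
    by (intro exI [of _ "\<lambda>n. r (q n)"] exI [of _ "\<lambda>t. (\<psi>' t, \<phi>' t)"])
      (auto intro!: tendsto_Pair)
qed

lemma almost_automorphic_compose2:
  assumes "almost_automorphic \<psi>" and "almost_automorphic \<phi>"
    and "continuous_on UNIV (\<lambda>p. h (fst p) (snd p))"
  shows "almost_automorphic (\<lambda>t. h (\<psi> t) (\<phi> t))"
  using almost_automorphic_compose [OF almost_automorphic_Pair [OF assms(1,2)] assms(3)]
  by simp

lemma almost_automorphic_add:
  assumes "almost_automorphic \<psi>" and "almost_automorphic \<phi>"
  shows "almost_automorphic (\<lambda>t. \<psi> t + \<phi> t)"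
  by (rule almost_automorphic_compose2 [OF assms]) (intro continuous_intros)

lemma almost_automorphic_scaleC:
  fixes \<phi> :: "real \<Rightarrow> 'a::complex_banach"
  assumes "almost_automorphic c" and "almost_automorphic \<phi>"
  shows "almost_automorphic (\<lambda>t. c t *\<^sub>C \<phi> t)"
  by (rule almost_automorphic_compose2 [OF assms])
    (intro scaleC.continuous_on continuous_intros)

lemma almost_automorphic_sum:
  assumes "\<And>i. i \<in> I \<Longrightarrow> almost_automorphic (\<psi> i)"
  shows "almost_automorphic (\<lambda>t. \<Sum>i\<in>I. \<psi> i t)"
  using assms
  by (induction I rule: infinite_finite_induct)
    (auto intro: almost_automorphic_const almost_automorphic_add)

lemma bounded_linear_axis: "bounded_linear (axis i :: 'a::real_normed_vector \<Rightarrow> 'a^'n)"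
proof
  fix x y :: 'a and r :: real
  show "axis i (x + y) = (axis i x + axis i y :: 'a^'n)"
    and "axis i (r *\<^sub>R x) = (r *\<^sub>R axis i x :: 'a^'n)"
    by (simp_all add: vec_eq_iff axis_def)
  have "norm (axis i x :: 'a^'n) \<le> (\<Sum>j\<in>UNIV. norm ((axis i x :: 'a^'n) $ j))" for x :: 'a
    by (simp add: norm_vec_def L2_set_le_sum)
  also have "(\<Sum>j\<in>UNIV. norm ((axis i x :: 'a^'n) $ j)) = norm x" for x :: 'a
    by (simp add: axis_def if_distrib cong: if_cong)
  finally show "\<exists>K. \<forall>x::'a. norm (axis i x :: 'a^'n) \<le> norm x * K"
    by (intro exI [of _ 1]) simp
qed

lemma vec_eq_sum_axis: "(x :: 'a::comm_monoid_add^'n) = (\<Sum>i\<in>UNIV. axis i (x $ i))"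
  by (simp add: vec_eq_iff axis_def)

text \<open>A vector is the sum of its coordinates placed on the axes, so closure under bounded
  linear maps and finite sums suffices.\<close>

lemma almost_automorphic_vecI:
  fixes \<psi> :: "real \<Rightarrow> 'a::banach^'n"
  assumes "\<And>i. almost_automorphic (\<lambda>t. \<psi> t $ i)"
  shows "almost_automorphic \<psi>"
proof -
  have "almost_automorphic (\<lambda>t. \<Sum>i\<in>UNIV. axis i (\<psi> t $ i))"
    by (intro almost_automorphic_sum almost_automorphic_compose [OF assms]
        linear_continuous_on bounded_linear_axis)
  then show ?thesis
    by (simp flip: vec_eq_sum_axis)
qed

lemma has_vector_derivative_vecI:
  fixes \<psi> :: "real \<Rightarrow> 'a::real_normed_vector^'n"
  assumes "\<And>i. ((\<lambda>t. \<psi> t $ i) has_vector_derivative D $ i) F"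
  shows "(\<psi> has_vector_derivative D) F"
proof -
  have "((\<lambda>t. \<Sum>i\<in>UNIV. axis i (\<psi> t $ i)) has_vector_derivative (\<Sum>i\<in>UNIV. axis i (D $ i))) F"
    by (intro has_vector_derivative_sum assms
        bounded_linear.has_vector_derivative [OF bounded_linear_axis])
  then show ?thesis
    by (simp flip: vec_eq_sum_axis)
qed

text \<open>Reflection turns a translation by \<sigma> into one by -\<sigma>, so the subsequence is
  chosen for the negated sequence.\<close>

lemma almost_automorphic_reflect:
  assumes "almost_automorphic \<psi>"
  shows "almost_automorphic (\<lambda>t. \<psi> (- t))"
proof (rule almost_automorphicI)
  show "continuous_on UNIV (\<lambda>t. \<psi> (- t))"
    using almost_automorphic_continuous [OF assms]
    by (intro continuous_on_compose2 [OF _ continuous_on_minus]) auto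
  fix \<sigma> :: "nat \<Rightarrow> real"
  obtain r \<psi>' where r: "strict_mono (r :: nat \<Rightarrow> nat)"
    and lim: "\<And>t. (\<lambda>n. \<psi> (t + - \<sigma> (r n))) \<longlonglongrightarrow> \<psi>' t"
      "\<And>t. (\<lambda>n. \<psi>' (t - - \<sigma> (r n))) \<longlonglongrightarrow> \<psi> t"
    using almost_automorphicE [OF assms, of "\<lambda>n. - \<sigma> n"] by metis
  have "(\<lambda>n. \<psi> (- (t + \<sigma> (r n)))) \<longlonglongrightarrow> \<psi>' (- t)"
    "(\<lambda>n. \<psi>' (- (t - \<sigma> (r n)))) \<longlonglongrightarrow> \<psi> (- t)" for t
    using lim(1) [of "- t"] lim(2) [of "- t"] by (simp_all add: add.commute)
  with r show "\<exists>r \<psi>'. strict_mono (r :: nat \<Rightarrow> nat) \<and>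
      (\<forall>t. (\<lambda>n. \<psi> (- (t + \<sigma> (r n)))) \<longlonglongrightarrow> \<psi>' t) \<and>
      (\<forall>t. (\<lambda>n. \<psi>' (t - \<sigma> (r n))) \<longlonglongrightarrow> \<psi> (- t))"
    by (intro exI [of _ r] exI [of _ "\<lambda>t. \<psi>' (- t)"]) blast
qed

text \<open>The values lie on the unit circle. By compactness \<open>?e (\<sigma> n)\<close> has a
  subsequence with a limit \<gamma> of modulus 1; translating forward multiplies by \<gamma> in the
  limit, and translating back multiplies by its conjugate, which is its inverse.\<close>

lemma almost_automorphic_exp:
  assumes "Re \<alpha> = 0"
  shows "almost_automorphic (\<lambda>t. exp (of_real t * \<alpha>))"
proof (rule almost_automorphicI)
  show "continuous_on UNIV (\<lambda>t. exp (complex_of_real t * \<alpha>))"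
    by (intro continuous_intros)
  fix \<sigma> :: "nat \<Rightarrow> real"
  let ?e = "\<lambda>t. exp (complex_of_real t * \<alpha>)"
  have norm1: "norm (?e t) = 1" for t
    using assms by (simp add: norm_exp_eq_Re)
  have e_add: "?e (s + t) = ?e s * ?e t" for s t
    by (simp add: distrib_right exp_add)
  \<comment> \<open>On the unit circle the inverse is the conjugate; in this form the limit along
    the subsequence can be taken factor by factor.\<close>
  have e_diff: "?e (s - t) = ?e s * cnj (?e t)" for s t
  proof -
    have "?e s = ?e (s - t) * ?e t"
      using e_add [of "s - t" t] by simp
    moreover have "?e t * cnj (?e t) = 1"
      by (simp only: complex_norm_square [symmetric] norm1) simp
    ultimately show ?thesis
      by simp
  qed
  have "seq_compact (cball (0::complex) 1)"
    using compact_cball compact_eq_seq_compact_metric by blast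
  moreover have "\<forall>n. ?e (\<sigma> n) \<in> cball 0 1"
    by (simp only: mem_cball_0 norm1) simp
  ultimately obtain \<gamma> r where r: "strict_mono (r :: nat \<Rightarrow> nat)"
    and "((\<lambda>n. ?e (\<sigma> n)) \<circ> r) \<longlonglongrightarrow> \<gamma>"
    by (rule seq_compactE)
  then have \<gamma>: "(\<lambda>n. ?e (\<sigma> (r n))) \<longlonglongrightarrow> \<gamma>"
    by (simp add: o_def)
  have "(\<lambda>n. norm (?e (\<sigma> (r n)))) \<longlonglongrightarrow> norm \<gamma>"
    using \<gamma> by (rule tendsto_norm)
  then have "1 = norm \<gamma>"
    by (simp only: norm1 LIMSEQ_const_iff)
  then have \<gamma>1: "\<gamma> * cnj \<gamma> = 1"
    by (simp flip: complex_norm_square)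
  have "(\<lambda>n. ?e (t + \<sigma> (r n))) \<longlonglongrightarrow> ?e t * \<gamma>" for t
    unfolding e_add by (intro tendsto_intros \<gamma>)
  moreover have "(\<lambda>n. ?e (t - \<sigma> (r n)) * \<gamma>) \<longlonglongrightarrow> ?e t * cnj \<gamma> * \<gamma>" for t
    unfolding e_diff by (intro tendsto_intros \<gamma>)
  ultimately show "\<exists>r \<psi>'. strict_mono (r :: nat \<Rightarrow> nat) \<and>
      (\<forall>t. (\<lambda>n. ?e (t + \<sigma> (r n))) \<longlonglongrightarrow> \<psi>' t) \<and>
      (\<forall>t. (\<lambda>n. \<psi>' (t - \<sigma> (r n))) \<longlonglongrightarrow> ?e t)"
    using r \<gamma>1
    by (intro exI [of _ r] exI [of _ "\<lambda>t. ?e t * \<gamma>"]) (auto simp: mult.assoc mult.commute [of "cnj \<gamma>"])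
qed

section \<open>Scalar equations with a purely imaginary coefficient\<close>

lemma oriented_integral_eq_diff:
  fixes F :: "real \<Rightarrow> 'a::banach"
  assumes "\<And>t. (F has_vector_derivative f t) (at t)"
  shows "oriented_integral a b f = F b - F a"
proof -
  have "integral {s..t} f = F t - F s" if "s \<le> t" for s t
    using fundamental_theorem_of_calculus [OF that, of F f] assms
    by (blast intro: integral_unique has_vector_derivative_at_within)
  then show ?thesis
    by (simp add: oriented_integral_def)
qed

text \<open>The exponential is the integrating factor: the terms containing \<alpha> cancel in the
  product rule.\<close>

lemma has_vector_derivative_exp_scaleC:
  fixes z :: "real \<Rightarrow> 'a::complex_banach"
  assumes "(z has_vector_derivative \<alpha> *\<^sub>C z t + d) (at t)"
  shows "((\<lambda>t. exp (of_real t * - \<alpha>) *\<^sub>C z t) has_vector_derivative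
    exp (of_real t * - \<alpha>) *\<^sub>C d) (at t)"
proof -
  let ?e = "\<lambda>t. exp (of_real t * - \<alpha>)"
  have "(?e has_vector_derivative (?e t * - \<alpha>)) (at t)"
    by (rule has_vector_derivative_real_field) (auto intro!: derivative_eq_intros)
  from scaleC.has_vector_derivative [OF this assms]
  have "((\<lambda>t. ?e t *\<^sub>C z t) has_vector_derivative
      ?e t *\<^sub>C (\<alpha> *\<^sub>C z t + d) + (?e t * - \<alpha>) *\<^sub>C z t) (at t)" .
  also have "?e t *\<^sub>C (\<alpha> *\<^sub>C z t + d) + (?e t * - \<alpha>) *\<^sub>C z t = ?e t *\<^sub>C d"
    by (simp add: scaleC_add_right scaleC_scaleC scaleC.minus_left)
  finally show ?thesis .
qed

text \<open>Multiplied by an exponential of modulus 1, z becomes, up to the constant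
  \<open>z 0\<close>, the integral of an almost automorphic function, and it stays bounded. The
  Bohl-Bohr property applies to that integral, and multiplying by the opposite exponential recovers
  z.\<close>

lemma almost_automorphic_scalar_imaginary:
  fixes z g :: "real \<Rightarrow> 'v::complex_banach"
  assumes bb: "bohl_bohr TYPE('v)" and g: "almost_automorphic g"
    and z': "\<And>t. (z has_vector_derivative \<alpha> *\<^sub>C z t + g t) (at t)"
    and z: "bounded (range z)" and \<alpha>: "Re \<alpha> = 0"
  shows "almost_automorphic z"
proof -
  let ?e = "\<lambda>t. exp (of_real t * - \<alpha>)"
  let ?F = "\<lambda>t. oriented_integral 0 t (\<lambda>s. ?e s *\<^sub>C g s)"
  have F: "?F t = ?e t *\<^sub>C z t - z 0" for t
    using oriented_integral_eq_diff
      [OF has_vector_derivative_exp_scaleC [OF z'], of 0 t] by (simp add: scaleC_one)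
  obtain B where B: "\<And>t. norm (z t) \<le> B"
    using z by (auto simp: bounded_iff)
  have "norm (?F t) \<le> B + norm (z 0)" for t
  proof -
    have "norm (?F t) \<le> norm (?e t *\<^sub>C z t) + norm (z 0)"
      unfolding F by (rule norm_triangle_ineq4)
    also have "norm (?e t *\<^sub>C z t) \<le> B"
      using \<alpha> B by (simp add: norm_scaleC norm_exp_eq_Re)
    finally show ?thesis by simp
  qed
  then have "bounded (range ?F)"
    by (auto simp: bounded_iff)
  moreover have "almost_automorphic (\<lambda>s. ?e s *\<^sub>C g s)"
    using almost_automorphic_exp [of "- \<alpha>"] \<alpha> g by (simp add: almost_automorphic_scaleC)
  ultimately have F_aa: "almost_automorphic ?F"
    using bb by (simp add: bohl_bohr_def)
  have "exp (of_real t * \<alpha>) *\<^sub>C (?F t + z 0) = z t" for t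
    unfolding F by (simp add: scaleC_scaleC scaleC_one flip: exp_add)
  moreover have "almost_automorphic (\<lambda>t. exp (of_real t * \<alpha>) *\<^sub>C (?F t + z 0))"
    using \<alpha> F_aa by (intro almost_automorphic_scaleC almost_automorphic_exp
        almost_automorphic_add almost_automorphic_const)
  ultimately show ?thesis
    by (simp only:)
qed

section \<open>Scalar equations with a coefficient off the imaginary axis\<close>

lemma has_vector_derivative_translate:
  fixes z :: "real \<Rightarrow> 'a::real_normed_vector"
  assumes "(z has_vector_derivative d) (at (t + c))"
  shows "((\<lambda>x. z (x + c)) has_vector_derivative d) (at t)"
proof -
  have "((\<lambda>x. x + c) has_vector_derivative 1) (at t)"
    by (simp add: has_vector_derivative_add_const)
  from vector_diff_chain_at [OF this assms] show ?thesis
    by (simp add: o_def)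
qed

lemma integrable_exp_weighted:
  fixes w :: "real \<Rightarrow> real"
  assumes a: "0 < a" and w: "continuous_on UNIV w" and B: "\<And>s. norm (w s) \<le> B"
  shows "(\<lambda>s. exp (- a * s) * w s) integrable_on {0..}"
proof (rule measurable_bounded_by_integrable_imp_integrable)
  show "(\<lambda>s. exp (- a * s) * w s) \<in> borel_measurable (lebesgue_on {0..})"
    by (intro continuous_imp_measurable_on_sets_lebesgue continuous_intros
        continuous_on_subset [OF w]) auto
  show "(\<lambda>s. exp (- a * s) * B) integrable_on {0..}"
    by (intro integrable_on_mult_left integrable_on_exp_minus_to_infinity a)
  show "norm (exp (- a * s) * w s) \<le> exp (- a * s) * B" for s
    using B [of s] by (simp add: abs_mult)
qed auto

text \<open>The function \<open>exp (- a * s) * B\<close> is an integrable majorant on the half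
  line. Integrability of the limit is part of the conclusion because w' will be known only as a
  pointwise limit.\<close>

lemma exp_weighted_dominated_convergence:
  fixes w :: "nat \<Rightarrow> real \<Rightarrow> real"
  assumes a: "0 < a" and w: "\<And>n. (\<lambda>s. exp (- a * s) * w n s) integrable_on {0..}"
    and B: "\<And>n s. norm (w n s) \<le> B" and lim: "\<And>s. (\<lambda>n. w n s) \<longlonglongrightarrow> w' s"
  shows "(\<lambda>s. exp (- a * s) * w' s) integrable_on {0..}"
    and "(\<lambda>n. integral {0..} (\<lambda>s. exp (- a * s) * w n s))
      \<longlonglongrightarrow> integral {0..} (\<lambda>s. exp (- a * s) * w' s)"
proof -
  have h: "(\<lambda>s. exp (- a * s) * B) integrable_on {0..}"
    by (intro integrable_on_mult_left integrable_on_exp_minus_to_infinity a)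
  have le: "norm (exp (- a * s) * w n s) \<le> exp (- a * s) * B" for n s
    using B [of n s] by (simp add: abs_mult)
  show "(\<lambda>s. exp (- a * s) * w' s) integrable_on {0..}"
    "(\<lambda>n. integral {0..} (\<lambda>s. exp (- a * s) * w n s))
      \<longlonglongrightarrow> integral {0..} (\<lambda>s. exp (- a * s) * w' s)"
    by (rule dominated_convergence [OF w h le tendsto_mult_left [OF lim]]; assumption)+
qed

text \<open>Integrating \<open>?e s *\<^sub>C h (t + s)\<close> over [0, T] expresses
  \<open>u t\<close> through this integral and the boundary term
  \<open>?e T *\<^sub>C u (t + T)\<close>. Since u is bounded and Re \<alpha> > 0, the boundary term
  vanishes as T tends to infinity.\<close>

lemma norm_bounded_solution_le:
  fixes u h :: "real \<Rightarrow> 'v::complex_banach"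
  assumes \<alpha>: "0 < Re \<alpha>"
    and u': "\<And>t. (u has_vector_derivative \<alpha> *\<^sub>C u t + h t) (at t)"
    and u: "bounded (range u)" and h: "continuous_on UNIV h" "bounded (range h)"
  shows "norm (u t) \<le> integral {0..} (\<lambda>s. exp (- Re \<alpha> * s) * norm (h (t + s)))"
proof -
  let ?I = "integral {0..} (\<lambda>s. exp (- Re \<alpha> * s) * norm (h (t + s)))"
  let ?e = "\<lambda>s. exp (of_real s * - \<alpha>)"
  obtain B where B: "\<And>t. norm (u t) \<le> B"
    using u by (auto simp: bounded_iff)
  obtain C where C: "\<And>t. norm (h t) \<le> C"
    using h by (auto simp: bounded_iff)
  have e: "norm (?e s *\<^sub>C x) = exp (- Re \<alpha> * s) * norm x" for s and x :: 'v
    by (simp add: norm_scaleC norm_exp_eq_Re mult.commute)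
  have cont: "continuous_on UNIV (\<lambda>s. norm (h (t + s)))"
    by (intro continuous_intros continuous_on_compose2 [OF h(1)]) auto
  have int: "(\<lambda>s. exp (- Re \<alpha> * s) * norm (h (t + s))) integrable_on {0..}"
    by (rule integrable_exp_weighted [OF \<alpha> cont, where B = C]) (simp add: C)
  have "norm (u t) \<le> ?I + exp (- Re \<alpha> * T) * B" if T: "0 \<le> T" for T
  proof -
    have u'': "((\<lambda>s. u (t + s)) has_vector_derivative \<alpha> *\<^sub>C u (t + s) + h (t + s)) (at s)" for s
      using has_vector_derivative_translate [where t = s and c = t, OF u'] by (simp add: add.commute)
    have "((\<lambda>s. ?e s *\<^sub>C u (t + s)) has_vector_derivative ?e s *\<^sub>C h (t + s)) (at s within S)"
      for s S
      by (rule has_vector_derivative_at_within [OF has_vector_derivative_exp_scaleC [OF u'']])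
    from fundamental_theorem_of_calculus [OF T this]
    have FTC: "((\<lambda>s. ?e s *\<^sub>C h (t + s)) has_integral
        (?e T *\<^sub>C u (t + T) - ?e 0 *\<^sub>C u (t + 0))) {0..T}" .
    have int_T: "(\<lambda>s. exp (- Re \<alpha> * s) * norm (h (t + s))) integrable_on {0..T}"
      by (rule integrable_continuous_interval)
        (intro continuous_intros continuous_on_subset [OF cont] subset_UNIV)
    have "norm (integral {0..T} (\<lambda>s. ?e s *\<^sub>C h (t + s)))
        \<le> integral {0..T} (\<lambda>s. exp (- Re \<alpha> * s) * norm (h (t + s)))"
      by (rule integral_norm_bound_integral [OF has_integral_integrable [OF FTC] int_T]) (simp only: e)
    also have "\<dots> \<le> ?I"
      using int_T int by (intro integral_subset_le) auto
    finally have "norm (?e T *\<^sub>C u (t + T) - u t) \<le> ?I"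
      using FTC by (simp add: integral_unique scaleC_one)
    moreover have "norm (?e T *\<^sub>C u (t + T)) \<le> exp (- Re \<alpha> * T) * B"
      unfolding e using B by (intro mult_left_mono) auto
    ultimately show ?thesis
      using norm_triangle_ineq2 [of "u t" "?e T *\<^sub>C u (t + T)"] by (simp add: norm_minus_commute)
  qed
  moreover have "((\<lambda>T. ?I + exp (- Re \<alpha> * T) * B) \<longlongrightarrow> ?I + 0 * B) at_top"
    using \<alpha> by (intro tendsto_intros filterlim_compose [OF exp_at_bot]
        filterlim_tendsto_neg_mult_at_bot [OF tendsto_const] filterlim_ident) auto
  ultimately show ?thesis
    using tendsto_lowerbound [of "\<lambda>T. ?I + exp (- Re \<alpha> * T) * B" ?I at_top "norm (u t)"]
    by (auto simp: eventually_at_top_linorder)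
qed

text \<open>Translates of \<open>g\<close> converge only pointwise, so the convergence of the translates of \<open>z\<close>
  comes from dominated convergence, applied to the real integrals bounding their differences.\<close>

lemma almost_automorphic_scalar_positive:
  fixes z g :: "real \<Rightarrow> 'v::complex_banach"
  assumes g: "almost_automorphic g"
    and z': "\<And>t. (z has_vector_derivative \<alpha> *\<^sub>C z t + g t) (at t)"
    and z: "bounded (range z)" and \<alpha>: "0 < Re \<alpha>"
  shows "almost_automorphic z"
proof (rule almost_automorphicI)
  show "continuous_on UNIV z"
    using z' by (intro continuous_at_imp_continuous_on ballI has_vector_derivative_continuous) auto
  fix \<sigma> :: "nat \<Rightarrow> real"
  obtain r g' where r: "strict_mono (r :: nat \<Rightarrow> nat)"
    and g': "\<And>t. (\<lambda>n. g (t + \<sigma> (r n))) \<longlonglongrightarrow> g' t"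
      "\<And>t. (\<lambda>n. g' (t - \<sigma> (r n))) \<longlonglongrightarrow> g t"
    using almost_automorphicE [OF g, of \<sigma>] by metis
  define \<tau> where "\<tau> n = \<sigma> (r n)" for n
  note g' = g' [folded \<tau>_def]
  obtain B where B: "\<And>t. norm (g t) \<le> B"
    using almost_automorphic_bounded [OF g] by (auto simp: bounded_iff)
  have B': "norm (g' t) \<le> B" for t
    using B by (intro LIMSEQ_le_const2 [OF tendsto_norm [OF g'(1)]]) blast
  have diff_le: "norm (norm (x - y)) \<le> 2 * B" if "norm x \<le> B" "norm y \<le> B" for x y :: 'v
    using norm_triangle_ineq4 [of x y] that by simp
  have cont: "continuous_on UNIV (\<lambda>s. g (t + s + c))" for t c
    by (intro continuous_on_compose2 [OF almost_automorphic_continuous [OF g]] continuous_intros) auto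
  define K where "K w = (\<lambda>s. exp (- Re \<alpha> * s) * w s)" for w :: "real \<Rightarrow> real"
  let ?I = "\<lambda>w. integral {0..} (K w)"
  have K_int: "K (\<lambda>s. norm (g (t + s + \<tau> n) - g (t + s + \<tau> m))) integrable_on {0..}" for t n m
    unfolding K_def
    by (rule integrable_exp_weighted [OF \<alpha>, where B = "2 * B"])
      (intro continuous_intros cont diff_le B)+
  \<comment> \<open>The limit g' has no known continuity, so integrability is obtained by dominated
    convergence in m, with n fixed.\<close>
  have K_int': "K (\<lambda>s. norm (g (t + s + \<tau> n) - g' (t + s))) integrable_on {0..}" for t n
    unfolding K_def
  proof (rule exp_weighted_dominated_convergence(1) [OF \<alpha>])
    show "(\<lambda>s. exp (- Re \<alpha> * s) * norm (g (t + s + \<tau> n) - g (t + s + \<tau> m))) integrable_on {0..}" for m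
      by (rule K_int [unfolded K_def])
    show "norm (norm (g (t + s + \<tau> n) - g (t + s + \<tau> m))) \<le> 2 * B" for m s
      by (intro diff_le B)
    show "(\<lambda>m. norm (g (t + s + \<tau> n) - g (t + s + \<tau> m))) \<longlonglongrightarrow> norm (g (t + s + \<tau> n) - g' (t + s))" for s
      by (intro tendsto_intros g')
  qed
  \<comment> \<open>This weighted distance between a translate of g and g' will bound the distance
    between the corresponding translate of z and its limit.\<close>
  define J where "J t n = ?I (\<lambda>s. norm (g (t + s + \<tau> n) - g' (t + s)))" for t n
  have J_lim: "J t \<longlonglongrightarrow> 0" for t
  proof -
    have "(\<lambda>n. norm (g (t + s + \<tau> n) - g' (t + s))) \<longlonglongrightarrow> 0" for s
      using g'(1) [of "t + s"] by (simp add: LIM_zero tendsto_norm_zero)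
    from exp_weighted_dominated_convergence(2) [OF \<alpha> K_int' [unfolded K_def] _ this, of "2 * B"]
    show ?thesis
      by (simp add: J_def [abs_def] K_def diff_le [OF B B', simplified])
  qed
  \<comment> \<open>The base point moves with n here. After rewriting, the integrand compares
    \<open>g (t + s)\<close> with \<open>g' (t + s - \<tau> n)\<close>, so the second limit of
    almost automorphy makes it tend to 0.\<close>
  have J_lim': "(\<lambda>n. J (t - \<tau> n) n) \<longlonglongrightarrow> 0" for t
  proof -
    have eq: "J (t - \<tau> n) n = ?I (\<lambda>s. norm (g (t + s) - g' (t + s - \<tau> n)))" for n
      by (simp add: J_def algebra_simps)
    have int: "K (\<lambda>s. norm (g (t + s) - g' (t + s - \<tau> n))) integrable_on {0..}" for n
      using K_int' [of "t - \<tau> n" n] by (simp add: algebra_simps)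
    have "(\<lambda>n. norm (g (t + s) - g' (t + s - \<tau> n))) \<longlonglongrightarrow> norm (g (t + s) - g (t + s))" for s
      by (intro tendsto_intros g')
    then have "(\<lambda>n. norm (g (t + s) - g' (t + s - \<tau> n))) \<longlonglongrightarrow> 0" for s
      by simp
    from exp_weighted_dominated_convergence(2) [OF \<alpha> int [unfolded K_def] _ this, of "2 * B"]
    show ?thesis
      by (simp add: eq K_def diff_le [OF B B', simplified])
  qed
  \<comment> \<open>By linearity the difference of two translates of z solves the same equation,
    forced by the difference of the translates of g.\<close>
  have z_diff: "norm (z (t + \<tau> n) - z (t + \<tau> m)) \<le> J t n + J t m" for t n m
  proof -
    let ?u = "\<lambda>x. z (x + \<tau> n) - z (x + \<tau> m)" and ?h = "\<lambda>x. g (x + \<tau> n) - g (x + \<tau> m)"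
    have "(?u has_vector_derivative \<alpha> *\<^sub>C ?u x + ?h x) (at x)" for x
      using has_vector_derivative_diff 
        [OF has_vector_derivative_translate [where t = x and c = "\<tau> n", OF z']
          has_vector_derivative_translate [where t = x and c = "\<tau> m", OF z']]
      by (simp add: scaleC.diff_right algebra_simps)
    moreover have "bounded (range ?u)"
    proof -
      obtain C where "\<And>t. norm (z t) \<le> C"
        using z by (auto simp: bounded_iff)
      then have "norm (?u x) \<le> C + C" for x
        by (meson add_mono norm_triangle_ineq4 order_trans)
      then show ?thesis
        by (auto simp: bounded_iff)
    qed
    moreover have "continuous_on UNIV ?h"
      using cont [of 0] by (auto intro: continuous_on_diff)
    moreover have "bounded (range ?h)"
      using diff_le [OF B B] by (auto simp: bounded_iff)
    ultimately have "norm (?u t) \<le> ?I (\<lambda>s. norm (g (t + s + \<tau> n) - g (t + s + \<tau> m)))"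
      unfolding K_def by (rule norm_bounded_solution_le [OF \<alpha>])
    \<comment> \<open>Inserting g' between the two translates splits the bound into terms depending
      on n alone and on m alone, which gives the Cauchy property.\<close>
    also have "\<dots> \<le> integral {0..} (\<lambda>s. K (\<lambda>s. norm (g (t + s + \<tau> n) - g' (t + s))) s
        + K (\<lambda>s. norm (g (t + s + \<tau> m) - g' (t + s))) s)"
    proof (intro integral_le K_int integrable_add K_int')
      fix s :: real
      have "norm (g (t + s + \<tau> n) - g (t + s + \<tau> m))
          \<le> norm (g (t + s + \<tau> n) - g' (t + s)) + norm (g (t + s + \<tau> m) - g' (t + s))"
        by norm
      then show "K (\<lambda>s. norm (g (t + s + \<tau> n) - g (t + s + \<tau> m))) s
        \<le> K (\<lambda>s. norm (g (t + s + \<tau> n) - g' (t + s))) s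
          + K (\<lambda>s. norm (g (t + s + \<tau> m) - g' (t + s))) s"
        by (simp add: K_def flip: distrib_left)
    qed
    also have "\<dots> = J t n + J t m"
      unfolding J_def by (intro integral_add K_int')
    finally show ?thesis .
  qed
  have "Cauchy (\<lambda>n. z (t + \<tau> n))" for t
  proof (rule metric_CauchyI)
    fix e :: real assume "0 < e"
    then obtain N where N: "\<And>n. n \<ge> N \<Longrightarrow> norm (J t n) < e / 2"
      using LIMSEQ_D [OF J_lim, of "e / 2" t] by auto
    have "dist (z (t + \<tau> m)) (z (t + \<tau> n)) < e" if "m \<ge> N" "n \<ge> N" for m n
      using z_diff [of t m n] N [OF that(1)] N [OF that(2)] by (simp add: dist_norm)
    then show "\<exists>M. \<forall>m\<ge>M. \<forall>n\<ge>M. dist (z (t + \<tau> m)) (z (t + \<tau> n)) < e"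
      by blast
  qed
  then have "\<forall>t. \<exists>l. (\<lambda>n. z (t + \<tau> n)) \<longlonglongrightarrow> l"
    by (simp add: Cauchy_convergent_iff convergent_def)
  from choice [OF this]
  obtain \<zeta> where \<zeta>: "\<And>t. (\<lambda>n. z (t + \<tau> n)) \<longlonglongrightarrow> \<zeta> t"
    by blast
  \<comment> \<open>Letting m tend to infinity in \<open>z_diff\<close> removes the term
    \<open>J t m\<close>.\<close>
  have z_\<zeta>: "norm (z (t + \<tau> n) - \<zeta> t) \<le> J t n" for t n
  proof (rule LIMSEQ_le)
    show "(\<lambda>m. norm (z (t + \<tau> n) - z (t + \<tau> m))) \<longlonglongrightarrow> norm (z (t + \<tau> n) - \<zeta> t)"
      by (intro tendsto_intros \<zeta>)
    show "(\<lambda>m. J t n + J t m) \<longlonglongrightarrow> J t n"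
      using tendsto_add [OF tendsto_const J_lim, of "J t n" t] by simp
  qed (use z_diff in blast)
  have "(\<lambda>n. \<zeta> (t - \<tau> n) - z t) \<longlonglongrightarrow> 0" for t
  proof (rule Lim_null_comparison [OF always_eventually J_lim'], rule allI)
    show "norm (\<zeta> (t - \<tau> n) - z t) \<le> J (t - \<tau> n) n" for n
      using z_\<zeta> [of "t - \<tau> n" n] by (simp add: norm_minus_commute)
  qed
  then have "(\<lambda>n. \<zeta> (t - \<tau> n)) \<longlonglongrightarrow> z t" for t
    by (rule LIM_zero_cancel)
  with r \<zeta> show "\<exists>r z'. strict_mono (r :: nat \<Rightarrow> nat) \<and>
      (\<forall>t. (\<lambda>n. z (t + \<sigma> (r n))) \<longlonglongrightarrow> z' t) \<and> (\<forall>t. (\<lambda>n. z' (t - \<sigma> (r n))) \<longlonglongrightarrow> z t)"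
    unfolding \<tau>_def by blast
qed

lemma almost_automorphic_scalar:
  fixes z g :: "real \<Rightarrow> 'v::complex_banach"
  assumes "bohl_bohr TYPE('v)" and g: "almost_automorphic g"
    and z': "\<And>t. (z has_vector_derivative \<alpha> *\<^sub>C z t + g t) (at t)"
    and z: "bounded (range z)"
  shows "almost_automorphic z"
proof -
  consider "Re \<alpha> = 0" | "0 < Re \<alpha>" | "Re \<alpha> < 0"
    by linarith
  then show ?thesis
  proof cases
    case 1
    then show ?thesis
      using almost_automorphic_scalar_imaginary assms by blast
  next
    case 2
    then show ?thesis
      using almost_automorphic_scalar_positive g z' z by blast
  next
    case 3
    have "(uminus has_vector_derivative - 1) (at t)" for t :: real
      using has_vector_derivative_minus [OF has_vector_derivative_id] .
    \<comment> \<open>Time reversal negates the coefficient, whose real part becomes positive. The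
      reversed forcing term is written as a multiple by -1 so that closure under scalar
      multiplication covers it.\<close>
    from vector_diff_chain_at [OF this z']
    have deriv: "((\<lambda>t. z (- t)) has_vector_derivative
        (- \<alpha>) *\<^sub>C z (- t) + (-1) *\<^sub>C g (- t)) (at t)" for t
      by (simp add: o_def scaleC.minus_left scaleC_one)
    have bdd: "bounded (range (\<lambda>t. z (- t)))"
      using z by (auto simp: bounded_iff)
    have aa: "almost_automorphic (\<lambda>t. (-1) *\<^sub>C g (- t))"
      by (intro almost_automorphic_scaleC almost_automorphic_const almost_automorphic_reflect g)
    have "almost_automorphic (\<lambda>t. z (- t))"
      by (rule almost_automorphic_scalar_positive [OF aa deriv bdd]) (simp add: 3)
    from almost_automorphic_reflect [OF this] show ?thesis
      by simp
  qed
qed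

section \<open>Action of matrices, and of polynomials in a matrix, on \<open>V^p\<close>\<close>

lemma bounded_bilinear_mat_act:
  "bounded_bilinear (mat_act :: complex^'p^'p \<Rightarrow> 'v::complex_banach^'p \<Rightarrow> 'v^'p)"
proof
  fix A B :: "complex^'p^'p" and x y :: "'v^'p" and r :: real
  show "(A + B) *\<^sub>V x = A *\<^sub>V x + B *\<^sub>V x"
    by (simp add: mat_act_def vec_eq_iff scaleC_add_left sum.distrib)
  show "A *\<^sub>V (x + y) = A *\<^sub>V x + A *\<^sub>V y"
    by (simp add: mat_act_def vec_eq_iff scaleC_add_right sum.distrib)
  show "(r *\<^sub>R A) *\<^sub>V x = r *\<^sub>R (A *\<^sub>V x)"
    by (simp add: mat_act_def vec_eq_iff scaleC.scaleR_left scaleR_sum_right)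
  show "A *\<^sub>V (r *\<^sub>R x) = r *\<^sub>R (A *\<^sub>V x)"
    by (simp add: mat_act_def vec_eq_iff scaleC.scaleR_right scaleR_sum_right)
  \<comment> \<open>Each product of an entry of A with a component of x has norm at most
    \<open>norm A * norm x\<close>; the constant counts these products.\<close>
  have "norm (A *\<^sub>V x) \<le> norm A * norm x * (real CARD('p) * real CARD('p))"
    for A :: "complex^'p^'p" and x :: "'v^'p"
  proof -
    have "norm (A *\<^sub>V x) \<le> (\<Sum>i\<in>UNIV. norm ((A *\<^sub>V x) $ i))"
      by (simp add: norm_vec_def L2_set_le_sum)
    also have "\<dots> \<le> (\<Sum>i\<in>(UNIV :: 'p set). \<Sum>j\<in>(UNIV :: 'p set). norm A * norm x)"
    proof (rule sum_mono)
      fix i :: 'p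
      have "norm ((A *\<^sub>V x) $ i) \<le> (\<Sum>j\<in>UNIV. norm (A $ i $ j *\<^sub>C x $ j))"
        by (simp add: mat_act_def norm_sum)
      also have "\<dots> \<le> (\<Sum>j\<in>(UNIV :: 'p set). norm A * norm x)"
      proof (rule sum_mono)
        fix j :: 'p
        have "norm (A $ i $ j) \<le> norm A"
          by (rule order_trans [OF Finite_Cartesian_Product.norm_nth_le
                Finite_Cartesian_Product.norm_nth_le])
        then show "norm (A $ i $ j *\<^sub>C x $ j) \<le> norm A * norm x"
          by (simp add: norm_scaleC mult_mono Finite_Cartesian_Product.norm_nth_le)
      qed
      finally show "norm ((A *\<^sub>V x) $ i) \<le> (\<Sum>j\<in>(UNIV :: 'p set). norm A * norm x)" .
    qed
    finally show ?thesis
      by (simp add: mult_ac)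
  qed
  then show "\<exists>K. \<forall>(A :: complex^'p^'p) (x :: 'v^'p). norm (A *\<^sub>V x) \<le> norm A * norm x * K"
    by blast
qed

interpretation mat_act: bounded_bilinear
  "mat_act :: complex^'p^'p \<Rightarrow> 'v::complex_banach^'p \<Rightarrow> 'v^'p"
  by (rule bounded_bilinear_mat_act)

lemma mat_act_mat_one: "mat 1 *\<^sub>V x = x"
  by (simp add: mat_act_def mat_def vec_eq_iff if_distrib [of "\<lambda>c. c *\<^sub>C _"] scaleC_one
      scaleC.zero_left cong: if_cong)

lemma mat_act_matrix_mult: "(A ** B) *\<^sub>V x = A *\<^sub>V (B *\<^sub>V x)"
proof -
  have "((A ** B) *\<^sub>V x) $ i = (A *\<^sub>V (B *\<^sub>V x)) $ i" for i
  proof -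
    have "((A ** B) *\<^sub>V x) $ i = (\<Sum>j\<in>UNIV. \<Sum>k\<in>UNIV. A $ i $ k *\<^sub>C B $ k $ j *\<^sub>C x $ j)"
      by (simp add: mat_act_def matrix_matrix_mult_def scaleC.sum_left scaleC_scaleC)
    also have "\<dots> = (\<Sum>k\<in>UNIV. \<Sum>j\<in>UNIV. A $ i $ k *\<^sub>C B $ k $ j *\<^sub>C x $ j)"
      by (rule sum.swap)
    also have "\<dots> = (A *\<^sub>V (B *\<^sub>V x)) $ i"
      by (simp add: mat_act_def scaleC.sum_right)
    finally show ?thesis .
  qed
  then show ?thesis
    by (simp add: vec_eq_iff)
qed

lemma mat_act_mat: "(mat c *\<^sub>V x) $ i = c *\<^sub>C x $ i"
  by (simp add: mat_act_def mat_def if_distrib [of "\<lambda>c. c *\<^sub>C _"] scaleC.zero_left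
      cong: if_cong)

lemma mat_commute: "A ** mat c = mat c ** (A :: complex^'p^'p)"
  by (simp add: vec_eq_iff matrix_matrix_mult_def mat_def if_distrib [of "\<lambda>c. _ * c"]
      if_distrib [of "\<lambda>c. c * _"] mult.commute cong: if_cong)

text \<open>Multiplication by scalars is written as the action of \<open>mat c\<close>, so that
  polynomials in \<open>A\<close> act on \<open>V\<^sup>p\<close> through \<open>(*\<^sub>V)\<close> alone.\<close>

definition poly_act :: "complex^'p^'p \<Rightarrow> complex poly \<Rightarrow> 'v::complex_banach^'p \<Rightarrow> 'v^'p"
  where "poly_act A q x = (\<Sum>k\<le>degree q. mat (coeff q k) *\<^sub>V ((mat_act A ^^ k) x))"

text \<open>Coefficients above the degree vanish. This permits a common summation range for
  polynomials whose exact degrees are not computed.\<close>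

lemma poly_act_eq_sum:
  assumes "degree q \<le> n"
  shows "poly_act A q x = (\<Sum>k\<le>n. mat (coeff q k) *\<^sub>V ((mat_act A ^^ k) x))"
  unfolding poly_act_def using assms
  by (intro sum.mono_neutral_left) (auto simp: coeff_eq_0 mat_act.zero_left)

lemma mat_act_funpow_diff: "(mat_act A ^^ k) (x - y) = (mat_act A ^^ k) x - (mat_act A ^^ k) y"
  by (induction k) (auto simp: mat_act.diff_right)

lemma mat_act_funpow_mat: "(mat_act A ^^ k) (mat c *\<^sub>V x) = mat c *\<^sub>V ((mat_act A ^^ k) x)"
  by (induction k) (auto simp: mat_commute simp flip: mat_act_matrix_mult)

text \<open>Both sides are sums over powers of A, compared by coefficients: multiplication by x - a
  shifts the coefficients of q by one and subtracts a times the unshifted ones. Thus if (x - a) q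
  annihilates a vector, q annihilates its image under A - a.\<close>

lemma poly_act_linear_factor:
  fixes A :: "complex^'p^'p" and x :: "'v::complex_banach^'p"
  shows "poly_act A ([:- a, 1:] * q) x = poly_act A q ((A - mat a) *\<^sub>V x)"
proof -
  have "poly_act A q ((A - mat a) *\<^sub>V x) =
      (\<Sum>k\<le>degree q. mat (coeff q k) *\<^sub>V ((mat_act A ^^ Suc k) x))
      - (\<Sum>k\<le>degree q. mat (a * coeff q k) *\<^sub>V ((mat_act A ^^ k) x))"
  proof -
    have "mat (coeff q k) *\<^sub>V ((mat_act A ^^ k) ((A - mat a) *\<^sub>V x)) =
        mat (coeff q k) *\<^sub>V ((mat_act A ^^ Suc k) x) - mat (a * coeff q k) *\<^sub>V ((mat_act A ^^ k) x)" for k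
    proof -
      have "mat (coeff q k) *\<^sub>V (mat a *\<^sub>V y) = mat (a * coeff q k) *\<^sub>V y" for y :: "'v^'p"
        by (simp add: vec_eq_iff mat_act_mat scaleC_scaleC mult.commute)
      then show ?thesis
        by (simp add: mat_act.diff_left mat_act.diff_right mat_act_funpow_diff mat_act_funpow_mat
            funpow_swap1)
    qed
    then show ?thesis
      by (simp add: poly_act_def sum_subtractf)
  qed
  also have "\<dots> = poly_act A ([:- a, 1:] * q) x"
  proof -
    let ?n = "Suc (degree q)"
    have "degree ([:- a, 1:] * q) \<le> ?n"
      using degree_mult_le [of "[:- a, 1:]" q] by simp
    then have "poly_act A ([:- a, 1:] * q) x =
        (\<Sum>k\<le>?n. mat (coeff ([:- a, 1:] * q) k) *\<^sub>V ((mat_act A ^^ k) x))"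
      by (rule poly_act_eq_sum)
    also have "\<dots> = (\<Sum>k\<le>?n. mat (coeff (pCons 0 q) k) *\<^sub>V ((mat_act A ^^ k) x))
        - (\<Sum>k\<le>?n. mat (a * coeff q k) *\<^sub>V ((mat_act A ^^ k) x))"
    proof -
      have "mat (c - d) = mat c - (mat d :: complex^'p^'p)" for c d
        by (simp add: mat_def vec_eq_iff)
      then show ?thesis
        by (simp add: mat_act.diff_left sum_subtractf del: sum.atMost_Suc)
    qed
    \<comment> \<open>The constant coefficient of \<open>pCons 0 q\<close> is 0, so the sum begins
      at k = 1 and the index can be shifted down.\<close>
    also have "(\<Sum>k\<le>?n. mat (coeff (pCons 0 q) k) *\<^sub>V ((mat_act A ^^ k) x)) =
        (\<Sum>k\<le>degree q. mat (coeff q k) *\<^sub>V ((mat_act A ^^ Suc k) x))"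
      by (simp add: sum.atMost_Suc_shift mat_act.zero_left del: sum.atMost_Suc funpow.simps)
    \<comment> \<open>The top term drops because its index exceeds the degree of q.\<close>
    also have "(\<Sum>k\<le>?n. mat (a * coeff q k) *\<^sub>V ((mat_act A ^^ k) x)) =
        (\<Sum>k\<le>degree q. mat (a * coeff q k) *\<^sub>V ((mat_act A ^^ k) x))"
      by (simp add: coeff_eq_0 mat_act.zero_left)
    finally show ?thesis ..
  qed
  finally show ?thesis ..
qed

section \<open>Existence of an annihilating polynomial\<close>

lemma exists_linear_relation:
  fixes M :: "nat \<Rightarrow> 'a::euclidean_space"
  obtains c :: "nat \<Rightarrow> real" and k n where "k \<le> n" "c k \<noteq> 0" "(\<Sum>i\<le>n. c i *\<^sub>R M i) = 0"
proof (cases "inj_on M {..DIM('a)}")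
  case True
  \<comment> \<open>The range of indices starts at 0, so an injective M yields one vector more than
    the dimension.\<close>
  then have "dependent (M ` {..DIM('a)})"
    by (intro dependent_biggerset) (simp add: card_image)
  then obtain u where u: "\<exists>v\<in>M ` {..DIM('a)}. u v \<noteq> 0"
    and "(\<Sum>v\<in>M ` {..DIM('a)}. u v *\<^sub>R v) = 0"
    by (auto simp: dependent_finite)
  then have "(\<Sum>i\<le>DIM('a). u (M i) *\<^sub>R M i) = 0"
    by (simp add: sum.reindex True)
  then show ?thesis
    using u that [of _ "DIM('a)" "u \<circ> M"] by auto
next
  case False
  then obtain i j where ij: "i \<le> DIM('a)" "j \<le> DIM('a)" "i \<noteq> j" "M i = M j"
    by (auto simp: inj_on_def)
  \<comment> \<open>A repeated value gives a relation directly, with coefficients 1 and -1.\<close>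
  let ?c = "\<lambda>k. if k = i then 1 else if k = j then - 1 else (0 :: real)"
  have "(\<Sum>k\<le>DIM('a). ?c k *\<^sub>R M k) = (\<Sum>k\<in>{i, j}. ?c k *\<^sub>R M k)"
    using ij by (intro sum.mono_neutral_right) auto
  also have "\<dots> = 0"
    using ij by simp
  finally show ?thesis
    using ij that [of i "DIM('a)" ?c] by simp
qed

text \<open>The powers of A lie in a finite-dimensional real space and hence satisfy a nontrivial
  linear relation. Its real coefficients, embedded in the complex numbers, are those of the
  polynomial.\<close>

lemma exists_annihilating_poly:
  fixes A :: "complex^'p^'p"
  obtains q where "q \<noteq> 0" "\<And>x :: 'v::complex_banach^'p. poly_act A q x = 0"
proof -
  define M where "M k = ((**) A ^^ k) (mat 1)" for k
  obtain c k n where c: "k \<le> n" "c k \<noteq> (0 :: real)" "(\<Sum>i\<le>n. c i *\<^sub>R M i) = 0"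
    using exists_linear_relation by metis
  let ?q = "\<Sum>i\<le>n. monom (complex_of_real (c i)) i"
  have coeff: "coeff ?q i = (if i \<le> n then of_real (c i) else 0)" for i
    by (simp add: coeff_sum if_distrib cong: if_cong)
  have M: "M i *\<^sub>V x = (mat_act A ^^ i) x" for i and x :: "'v^'p"
    by (induction i) (simp_all add: M_def mat_act_mat_one mat_act_matrix_mult)
  have scale: "mat (of_real r) *\<^sub>V x = r *\<^sub>R x" for r and x :: "'v^'p"
    by (simp add: vec_eq_iff mat_act_mat scaleC_of_real)
  have "poly_act A ?q x = 0" for x :: "'v^'p"
  proof -
    have "degree ?q \<le> n"
      by (rule degree_le) (simp add: coeff)
    then have "poly_act A ?q x = (\<Sum>i\<le>n. c i *\<^sub>R (mat_act A ^^ i) x)"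
      by (simp add: poly_act_eq_sum coeff scale)
    also have "\<dots> = (\<Sum>i\<le>n. c i *\<^sub>R M i) *\<^sub>V x"
      by (simp add: mat_act.sum_left mat_act.scaleR_left M)
    finally show ?thesis
      by (simp add: c mat_act.zero_left)
  qed
  moreover have "coeff ?q k \<noteq> 0"
    using c by (simp add: coeff)
  then have "?q \<noteq> 0"
    by (metis coeff_0)
  ultimately show ?thesis
    using that by blast
qed

section \<open>Systems: induction on the degree of the annihilating polynomial\<close>

lemma almost_automorphic_mat_act:
  fixes \<psi> :: "real \<Rightarrow> 'v::complex_banach^'p"
  assumes "almost_automorphic \<psi>"
  shows "almost_automorphic (\<lambda>t. A *\<^sub>V \<psi> t)"
  by (rule almost_automorphic_compose [OF assms])
    (rule linear_continuous_on [OF mat_act.bounded_linear_right])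

text \<open>Annihilation is required of the values of y only. In this form it passes from q and y to
  a quotient q1 and (A - a) y, where a is a root of q; the induction therefore generalises q, y and
  f.\<close>

lemma almost_automorphic_if_annihilated:
  fixes y f :: "real \<Rightarrow> 'v::complex_banach^'p"
  assumes bb: "bohl_bohr TYPE('v)" and "q \<noteq> 0" and "\<And>t. poly_act A q (y t) = 0"
    and "almost_automorphic f"
    and "\<And>t. (y has_vector_derivative A *\<^sub>V y t + f t) (at t)"
    and "bounded (range y)"
  shows "almost_automorphic y"
  using assms(2-)
proof (induction "degree q" arbitrary: q y f)
  case 0
  \<comment> \<open>A nonzero constant annihilates only the zero vector, so y vanishes.\<close>
  then obtain c where "q = [:c:]" "c \<noteq> 0"
    by (metis degree_eq_zeroE pCons_0_0)
  then have "mat c *\<^sub>V y t = 0" for t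
    using "0.prems"(2) [of t] by (simp add: poly_act_def)
  then have "y t $ i = 0" for t i
    using mat_act_mat [of c "y t" i] \<open>c \<noteq> 0\<close> norm_scaleC [of c "y t $ i"] by simp
  then have "y = (\<lambda>t. 0)"
    by (simp add: fun_eq_iff vec_eq_iff)
  then show ?case
    using almost_automorphic_const by simp
next
  case (Suc n)
  have "\<not> constant (poly q)"
    using Suc.hyps by (simp add: constant_degree)
  then obtain a where "poly q a = 0"
    using fundamental_theorem_of_algebra by blast
  then obtain q1 where q: "q = [:- a, 1:] * q1"
    by (auto simp: poly_eq_0_iff_dvd)
  have q1: "q1 \<noteq> 0" "degree q1 = n"
    using Suc.prems(1) Suc.hyps(2) q by (auto simp: degree_mult_eq simp del: mult_pCons_left)
  let ?z = "\<lambda>t. (A - mat a) *\<^sub>V y t"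
  have z: "almost_automorphic ?z"
  proof (rule Suc.hyps(1) [of q1 ?z "\<lambda>t. (A - mat a) *\<^sub>V f t"])
    show "poly_act A q1 (?z t) = 0" for t
      using Suc.prems(2) [of t] by (simp add: q poly_act_linear_factor del: mult_pCons_left)
    show "(?z has_vector_derivative A *\<^sub>V ?z t + (A - mat a) *\<^sub>V f t) (at t)" for t
    proof -
      have "(?z has_vector_derivative (A - mat a) *\<^sub>V (A *\<^sub>V y t + f t)) (at t)"
        using mat_act.bounded_linear_right Suc.prems(4)
        by (rule bounded_linear.has_vector_derivative)
      \<comment> \<open>The scalar matrix \<open>mat a\<close> commutes with A.\<close>
      also have "(A - mat a) *\<^sub>V (A *\<^sub>V y t + f t) = A *\<^sub>V ?z t + (A - mat a) *\<^sub>V f t"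
        using mat_act_funpow_mat [of 1 A a "y t"]
        by (simp add: mat_act.diff_left mat_act.diff_right mat_act.add_right)
      finally show ?thesis .
    qed
    show "bounded (range ?z)"
      using bounded_linear_image [OF Suc.prems(5) mat_act.bounded_linear_right, of "A - mat a"]
      by (simp add: image_image)
  qed (simp_all add: q1 almost_automorphic_mat_act Suc.prems)
  show ?case
  proof (rule almost_automorphic_vecI)
    fix i
    show "almost_automorphic (\<lambda>t. y t $ i)"
    proof (rule almost_automorphic_scalar [OF bb])
      show "almost_automorphic (\<lambda>t. (?z t + f t) $ i)"
        by (intro almost_automorphic_compose [OF almost_automorphic_add [OF z Suc.prems(3)]]
            linear_continuous_on bounded_linear_vec_nth)
      \<comment> \<open>Since \<open>?z t\<close> is (A - a) y, the term A y equals a y +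
        \<open>?z t\<close>, which decouples the components.\<close>
      show "((\<lambda>t. y t $ i) has_vector_derivative a *\<^sub>C y t $ i + (?z t + f t) $ i) (at t)" for t
        using bounded_linear.has_vector_derivative [OF bounded_linear_vec_nth Suc.prems(4), of i t]
        by (simp add: mat_act.diff_left mat_act_mat)
      show "bounded (range (\<lambda>t. y t $ i))"
        using bounded_linear_image [OF Suc.prems(5) bounded_linear_vec_nth, of i]
        by (simp add: image_image)
    qed
  qed
qed

section \<open>The matrix exponential, entry by entry\<close>

lemma suminf_vec_nth:
  fixes f :: "nat \<Rightarrow> 'a::real_normed_vector^'n"
  assumes "\<And>i. summable (\<lambda>k. f k $ i)"
  shows "summable f" and "suminf f $ i = (\<Sum>k. f k $ i)"
proof -
  have "f sums (\<chi> i. \<Sum>k. f k $ i)"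
    unfolding sums_def
    by (rule vec_tendstoI) (use summable_LIMSEQ [OF assms] in simp)
  then show "summable f" and "suminf f $ i = (\<Sum>k. f k $ i)"
    by (auto simp: sums_iff)
qed

definition mat_pow :: "complex^'p^'p \<Rightarrow> nat \<Rightarrow> complex^'p^'p"
  where "mat_pow A k = ((**) A ^^ k) (mat 1)"

lemma mat_pow_Suc: "mat_pow A (Suc k) = A ** mat_pow A k"
  by (simp add: mat_pow_def)

lemma mat_pow_Suc_right: "mat_pow A (Suc k) = mat_pow A k ** A"
proof (induction k)
  case 0
  show ?case
    by (simp add: mat_pow_def)
next
  case (Suc k)
  then show ?case
    by (metis mat_pow_Suc matrix_mul_assoc)
qed

lemma mat_pow_scaleR: "mat_pow (t *\<^sub>R A) k = t ^ k *\<^sub>R mat_pow A k"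
proof (induction k)
  case 0
  show ?case
    by (simp add: mat_pow_def)
next
  case (Suc k)
  then show ?case
    by (simp add: mat_pow_Suc vec_eq_iff matrix_matrix_mult_def scaleR_sum_right mult.commute)
qed

text \<open>The sum of the moduli of all entries dominates every row sum of A, so each further
  factor A contributes at most one factor of this sum.\<close>

lemma norm_mat_pow_le: "cmod (mat_pow A k $ i $ j) \<le> (\<Sum>i\<in>UNIV. \<Sum>j\<in>UNIV. cmod (A $ i $ j)) ^ k"
proof (induction k arbitrary: i)
  case 0
  show ?case
    by (simp add: mat_pow_def mat_def)
next
  case (Suc k)
  let ?C = "\<Sum>i\<in>UNIV. \<Sum>j\<in>UNIV. cmod (A $ i $ j)"
  have "cmod (mat_pow A (Suc k) $ i $ j) \<le> (\<Sum>l\<in>UNIV. cmod (A $ i $ l * mat_pow A k $ l $ j))"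
    by (simp add: mat_pow_Suc matrix_matrix_mult_def norm_sum)
  also have "\<dots> \<le> (\<Sum>l\<in>UNIV. cmod (A $ i $ l) * ?C ^ k)"
    by (intro sum_mono) (simp add: norm_mult mult_left_mono Suc.IH)
  also have "\<dots> = (\<Sum>l\<in>UNIV. cmod (A $ i $ l)) * ?C ^ k"
    by (simp add: sum_distrib_right)
  also have "\<dots> \<le> ?C * ?C ^ k"
    by (intro mult_right_mono member_le_sum [of i UNIV "\<lambda>i. \<Sum>j\<in>UNIV. cmod (A $ i $ j)"])
      (auto intro!: sum_nonneg zero_le_power)
  finally show ?case
    by simp
qed

text \<open>Comparison with an exponential series gives convergence for every complex z, so each
  entry is an entire power series and may be differentiated termwise.\<close>

lemma summable_mat_pow_series: "summable (\<lambda>k. mat_pow A k $ i $ j / fact k * z ^ k)"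
proof (rule summable_comparison_test')
  let ?C = "\<Sum>i\<in>UNIV. \<Sum>j\<in>UNIV. cmod (A $ i $ j)"
  show "summable (\<lambda>k. inverse (fact k) * (?C * cmod z) ^ k)"
    by (rule summable_exp)
  show "cmod (mat_pow A k $ i $ j / fact k * z ^ k) \<le> inverse (fact k) * (?C * cmod z) ^ k"
    for k
  proof -
    have "cmod (mat_pow A k $ i $ j / fact k * z ^ k) =
        inverse (fact k) * (cmod (mat_pow A k $ i $ j) * cmod z ^ k)"
      by (simp add: norm_mult norm_divide norm_power field_simps)
    also have "\<dots> \<le> inverse (fact k) * (?C ^ k * cmod z ^ k)"
      by (intro mult_left_mono mult_right_mono norm_mat_pow_le) auto
    finally show ?thesis
      by (simp add: power_mult_distrib)
  qed
qed

lemma mat_exp_nth: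
  "mat_exp (t *\<^sub>R A) $ i $ j = (\<Sum>k. mat_pow A k $ i $ j / fact k * of_real t ^ k)"
proof -
  let ?f = "\<lambda>k. mat_pow (t *\<^sub>R A) k /\<^sub>R fact k"
  have nth: "?f k $ i $ j = mat_pow A k $ i $ j / fact k * of_real t ^ k" for k i j
    by (simp add: mat_pow_scaleR scaleR_conv_of_real [where 'a = complex] divide_inverse)
  have "summable (\<lambda>k. ?f k $ i $ j)" for i j
    unfolding nth by (rule summable_mat_pow_series)
  \<comment> \<open>The componentwise limit is used twice: here for each row as a vector of entries,
    and below for the matrix as a vector of rows.\<close>
  note rows = suminf_vec_nth [OF this]
  have "mat_exp (t *\<^sub>R A) $ i $ j = suminf ?f $ i $ j"
    by (simp add: mat_exp_def mat_pow_def)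
  also have "\<dots> = (\<Sum>k. ?f k $ i $ j)"
    using suminf_vec_nth(2) [of ?f i, OF rows(1)] rows(2) [of i j] by simp
  finally show ?thesis
    unfolding nth .
qed

lemma mat_exp_zero: "mat_exp (0 *\<^sub>R A) = mat 1"
proof -
  have "mat_exp (0 *\<^sub>R A) $ i $ j = mat 1 $ i $ j" for i j
    unfolding mat_exp_nth by (simp only: of_real_0 powser_zero) (simp add: mat_pow_def)
  then show ?thesis
    unfolding vec_eq_iff by blast
qed

text \<open>Powers of A commute with A, so both products have the same series, which is also the
  termwise derivative. This serves both the commutation and the derivative of the
  exponential.\<close>

lemma mat_exp_derivative_nth:
  "(A ** mat_exp (t *\<^sub>R A)) $ i $ j = (\<Sum>k. mat_pow A (Suc k) $ i $ j / fact k * of_real t ^ k)"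
  "(mat_exp (t *\<^sub>R A) ** A) $ i $ j = (\<Sum>k. mat_pow A (Suc k) $ i $ j / fact k * of_real t ^ k)"
proof -
  let ?c = "\<lambda>i j k. mat_pow A k $ i $ j / fact k * of_real t ^ k"
  have "A $ i $ l * mat_exp (t *\<^sub>R A) $ l $ j = (\<Sum>k. A $ i $ l * ?c l j k)" for l
    unfolding mat_exp_nth by (rule suminf_mult [symmetric, OF summable_mat_pow_series])
  then have "(A ** mat_exp (t *\<^sub>R A)) $ i $ j = (\<Sum>l\<in>UNIV. \<Sum>k. A $ i $ l * ?c l j k)"
    by (simp add: matrix_matrix_mult_def)
  also have "\<dots> = (\<Sum>k. \<Sum>l\<in>UNIV. A $ i $ l * ?c l j k)"
    by (intro suminf_sum [symmetric] summable_mult summable_mat_pow_series)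
  finally show "(A ** mat_exp (t *\<^sub>R A)) $ i $ j =
      (\<Sum>k. mat_pow A (Suc k) $ i $ j / fact k * of_real t ^ k)"
    by (simp add: mat_pow_Suc matrix_matrix_mult_def sum_distrib_left sum_divide_distrib mult_ac)
  have "mat_exp (t *\<^sub>R A) $ i $ l * A $ l $ j = (\<Sum>k. ?c i l k * A $ l $ j)" for l
    unfolding mat_exp_nth by (rule suminf_mult2 [OF summable_mat_pow_series])
  then have "(mat_exp (t *\<^sub>R A) ** A) $ i $ j = (\<Sum>l\<in>UNIV. \<Sum>k. ?c i l k * A $ l $ j)"
    by (simp add: matrix_matrix_mult_def)
  also have "\<dots> = (\<Sum>k. \<Sum>l\<in>UNIV. ?c i l k * A $ l $ j)"
    by (intro suminf_sum [symmetric] summable_mult2 summable_mat_pow_series)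
  finally show "(mat_exp (t *\<^sub>R A) ** A) $ i $ j =
      (\<Sum>k. mat_pow A (Suc k) $ i $ j / fact k * of_real t ^ k)"
    by (simp add: mat_pow_Suc_right matrix_matrix_mult_def sum_distrib_left sum_divide_distrib
        mult_ac)
qed

lemma mat_exp_commute: "A ** mat_exp (t *\<^sub>R A) = mat_exp (t *\<^sub>R A) ** A"
  by (simp add: vec_eq_iff mat_exp_derivative_nth)

lemma has_vector_derivative_mat_exp:
  "((\<lambda>t. mat_exp (t *\<^sub>R A)) has_vector_derivative mat_exp (t *\<^sub>R A) ** A) (at t)"
proof (intro has_vector_derivative_vecI)
  fix i j
  let ?c = "\<lambda>k. mat_pow A k $ i $ j / fact k"
  \<comment> \<open>Termwise differentiation multiplies by k + 1, which reduces the factorial of k +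
    1 to that of k.\<close>
  have diffs: "diffs ?c = (\<lambda>k. mat_pow A (Suc k) $ i $ j / fact k)"
    by (simp add: diffs_def field_simps fun_eq_iff del: of_nat_Suc)
  have "((\<lambda>z. \<Sum>k. ?c k * z ^ k) has_field_derivative
      (mat_exp (t *\<^sub>R A) ** A) $ i $ j) (at (of_real t))"
    using termdiffs_strong_converges_everywhere [OF summable_mat_pow_series [of A i j], of "of_real t"]
    by (simp only: diffs mat_exp_derivative_nth)
  then show "((\<lambda>t. mat_exp (t *\<^sub>R A) $ i $ j) has_vector_derivative
      (mat_exp (t *\<^sub>R A) ** A) $ i $ j) (at t)"
    unfolding mat_exp_nth by (rule has_vector_derivative_real_field)
qed

lemma has_vector_derivative_mat_exp_minus:
  "((\<lambda>t. mat_exp (- (t *\<^sub>R A))) has_vector_derivative - (mat_exp (- (t *\<^sub>R A)) ** A)) (at t)"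
proof -
  have "(uminus has_vector_derivative - 1) (at t)"
    using has_vector_derivative_minus [OF has_vector_derivative_id] .
  from vector_diff_chain_at [OF this has_vector_derivative_mat_exp]
  show ?thesis
    by (simp add: o_def)
qed

text \<open>The derivative of the left-hand side in t is E A F x - E F A x, which is 0 because A
  commutes with F. The expression is therefore constant, and at t = 0 it equals x.\<close>

lemma mat_exp_mat_exp_minus: "mat_exp (t *\<^sub>R A) *\<^sub>V mat_exp (- (t *\<^sub>R A)) *\<^sub>V x = x"
proof -
  let ?E = "\<lambda>t. mat_exp (t *\<^sub>R A)" and ?F = "\<lambda>t. mat_exp (- (t *\<^sub>R A))"
  have F: "A ** ?F t = ?F t ** A" for t
    using mat_exp_commute [of A "- t"] by simp
  have "((\<lambda>t. ?E t *\<^sub>V ?F t *\<^sub>V x) has_vector_derivative 0) (at t within UNIV)" for t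
  proof -
    have "((\<lambda>t. ?F t *\<^sub>V x) has_vector_derivative - (?F t ** A) *\<^sub>V x) (at t)"
      by (rule bounded_linear.has_vector_derivative
          [OF mat_act.bounded_linear_left has_vector_derivative_mat_exp_minus])
    from mat_act.has_vector_derivative [OF has_vector_derivative_mat_exp [of A t] this]
    show ?thesis
      by (simp add: mat_act.minus_left mat_act.minus_right flip: F mat_act_matrix_mult)
        (simp add: matrix_mul_assoc)
  qed
  then obtain c where "\<And>t. t \<in> UNIV \<Longrightarrow> ?E t *\<^sub>V ?F t *\<^sub>V x = c"
    by (rule has_vector_derivative_zero_constant [OF convex_UNIV]) (rule that, blast)
  then have "?E t *\<^sub>V ?F t *\<^sub>V x = ?E 0 *\<^sub>V ?F 0 *\<^sub>V x"
    by (simp only: UNIV_I)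
  also have "\<dots> = x"
    using mat_exp_zero [of A] by (simp add: mat_act_mat_one)
  finally show ?thesis .
qed

section \<open>Variation of constants and the theorem\<close>

lemma variation_of_constants:
  fixes y f :: "real \<Rightarrow> 'v::complex_banach^'p"
  assumes y': "\<And>t. (y has_vector_derivative A *\<^sub>V y t + f t) (at t)"
  shows "y t = mat_exp (t *\<^sub>R A) *\<^sub>V
    (y 0 + oriented_integral 0 t (\<lambda>s. mat_exp (- (s *\<^sub>R A)) *\<^sub>V f s))"
proof -
  let ?F = "\<lambda>t. mat_exp (- (t *\<^sub>R A))"
  \<comment> \<open>The product rule gives - F A y + F (A y + f), where the terms in y cancel:
    \<open>?F\<close> is the integrating factor.\<close>
  have "((\<lambda>t. ?F t *\<^sub>V y t) has_vector_derivative ?F t *\<^sub>V f t) (at t)" for t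
    using mat_act.has_vector_derivative [OF has_vector_derivative_mat_exp_minus [of A t] y']
    by (simp add: mat_act.minus_left mat_act.add_right mat_act_matrix_mult)
  from oriented_integral_eq_diff [OF this, of 0 t]
  have "oriented_integral 0 t (\<lambda>s. ?F s *\<^sub>V f s) = ?F t *\<^sub>V y t - y 0"
    using mat_exp_zero [of A] by (simp add: mat_act_mat_one)
  then show ?thesis
    by (simp add: mat_exp_mat_exp_minus)
qed

theorem theorem3p3:
  fixes A :: "complex^'p^'p"
    and \<mu> :: "'p \<Rightarrow> complex"
    and f y :: "real \<Rightarrow> 'v::complex_banach^'p"
  assumes "bohl_bohr TYPE('v)"
    and "eigenvalue_family A \<mu>"
    and "\<And>i. cmod (\<mu> i) = 1"
    and "almost_automorphic f"
    and "\<And>t. (y has_vector_derivative (A *\<^sub>V y t + f t)) (at t)"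
    and "bounded (range y)"
  shows "almost_automorphic y \<and>
    (inj \<mu> \<longrightarrow>
      (\<exists>v :: 'v^'p. \<forall>t. y t =
        mat_exp (t *\<^sub>R A) *\<^sub>V
          (v + oriented_integral 0 t (\<lambda>s. mat_exp (- (s *\<^sub>R A)) *\<^sub>V f s))))"
proof -
  obtain q where "q \<noteq> 0" "\<And>x :: 'v^'p. poly_act A q x = 0"
    using exists_annihilating_poly by blast
  with assms have "almost_automorphic y"
    by (intro almost_automorphic_if_annihilated [of q A y f]) auto
  \<comment> \<open>The witness for v is the initial value \<open>y 0\<close>.\<close>
  moreover have "\<forall>t. y t = mat_exp (t *\<^sub>R A) *\<^sub>V
      (y 0 + oriented_integral 0 t (\<lambda>s. mat_exp (- (s *\<^sub>R A)) *\<^sub>V f s))"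
    using variation_of_constants assms(5) by blast
  ultimately show ?thesis
    by blast
qed

end
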